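(* The set $\mathbb{P}_1(\mathbb{R}) = \mathbb{R} \cup \{\infty\}$, equipped with the operation $+_L$ (given by $x_0 +_L x_1 = \frac{x_0+x_1}{1-x_0x_1}$, suitably interpreted at $\infty$ as in the context) and with $0$ as identity element, is a group, and $\infty$ is its unique nontrivial torsion point of order two, i.e. its unique element of order exactly two.
   Context: Let $\mathbb{P}_1(\mathbb{C}) = \mathbb{C} \cup \{\infty\}$ and $\mathbb{P}_1(\mathbb{R}) = \mathbb{R} \cup \{\infty\}$ (the one-point compactification of $\mathbb{R}$), and let $\mathbb{T} \subset \mathbb{C}^\times$ be the unit circle, a group under multiplication. Let $L : \mathbb{P}_1(\mathbb{C}) \to \mathbb{P}_1(\mathbb{C})$ be the fractional linear transformation $L(z) = \frac{1+iz}{1-iz}$, which maps $\mathbb{P}_1(\mathbb{R})$ bijectively to $\mathbb{T}$, with $L(\infty) = -1$. For $x_0, x_1 \in \mathbb{P}_1(\mathbb{R})$ the operation is $x_0 +_L x_1 := L^{-1}(L(x_0)\cdot L(x_1))$. This equals $\frac{x_0+x_1}{1-x_0x_1}$, where the fraction is interpreted in $\mathbb{P}_1(\mathbb{R})$: in homogeneous coordinates, $(a_0:b_0) +_L (a_1:b_1) = (a_0b_1 + a_1b_0 : b_0b_1 - a_0a_1)$, where $x \in \mathbb{R}$ corresponds to $(x:1)$ and $\infty$ to $(1:0)$. *)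

theory Defs
  imports Complex_Main "HOL-Algebra.Multiplicative_Group"
begin

text \<open>
  The projective line over a field, as the one-point compactification: \<^term>\<open>None\<close> is the
  point at infinity.
\<close>

type_synonym 'a proj_line = "'a option"

abbreviation Infty :: "'a proj_line"
  where "Infty \<equiv> None"

text \<open>
  The point \<open>(a : b)\<close>; only meaningful when \<open>(a, b) \<noteq> (0, 0)\<close>.
\<close>

definition of_hom :: "'a::field \<Rightarrow> 'a \<Rightarrow> 'a proj_line"
  where "of_hom a b = (if b = 0 then Infty else Some (a / b))"

definition to_hom :: "'a::field proj_line \<Rightarrow> 'a \<times> 'a"
  where "to_hom p = (case p of Some x \<Rightarrow> (x, 1) | Infty \<Rightarrow> (1, 0))"

text \<open>
  \<open>L(z) = (1 + \<i> z) / (1 - \<i> z)\<close> on the complex projective line: homogenised,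
  \<open>(a : b)\<close> goes to \<open>(b + \<i> a : b - \<i> a)\<close>.
\<close>

definition L :: "complex proj_line \<Rightarrow> complex proj_line"
  where "L p = (case to_hom p of (a, b) \<Rightarrow> of_hom (b + \<i> * a) (b - \<i> * a))"

lemma L_Some: "L (Some z) = (if 1 - \<i> * z = 0 then Infty else Some ((1 + \<i> * z) / (1 - \<i> * z)))"
  by (simp add: L_def to_hom_def of_hom_def)

lemma L_infty: "L Infty = Some (- 1)"
  by (simp add: L_def to_hom_def of_hom_def)

text \<open>
  The restriction of \<^const>\<open>L\<close> to the real projective line. Its values are finite, so they
  are taken in \<^typ>\<open>complex\<close>, where they can be multiplied.
\<close>

definition L_real :: "real proj_line \<Rightarrow> complex"
  where "L_real x = the (L (map_option complex_of_real x))"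

lemma one_minus_ii_real: "1 - \<i> * complex_of_real x \<noteq> 0"
  by (simp add: complex_eq_iff)

lemma L_map_of_real: "L (map_option complex_of_real x) = Some (L_real x)"
  using one_minus_ii_real by (cases x) (auto simp: L_real_def L_Some L_infty)

lemma bij_betw_L_real: "bij_betw L_real UNIV {z. norm z = 1}"
proof (rule bij_betw_imageI)
  have fin: "L_real (Some x) = (1 + \<i> * of_real x) / (1 - \<i> * of_real x)" for x
    using one_minus_ii_real by (simp add: L_real_def L_Some)
  have inf: "L_real Infty = - 1"
    by (simp add: L_real_def L_infty)
  have ne: "L_real (Some x) \<noteq> - 1" for x
  proof
    assume "L_real (Some x) = - 1"
    then have "1 + \<i> * of_real x = - (1 - \<i> * complex_of_real x)"
      unfolding fin using one_minus_ii_real by (simp add: divide_eq_eq)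
    then show False by (simp add: complex_eq_iff)
  qed
  have inj: "x = y" if "L_real (Some x) = L_real (Some y)" for x y
  proof -
    have "(1 + \<i> * of_real x) * (1 - \<i> * complex_of_real y) =
        (1 + \<i> * of_real y) * (1 - \<i> * complex_of_real x)"
      using that unfolding fin by (subst (asm) frac_eq_eq[OF one_minus_ii_real one_minus_ii_real])
    then show ?thesis by (simp add: complex_eq_iff)
  qed
  show "inj L_real"
  proof (rule injI)
    fix x y assume "L_real x = L_real y"
    then show "x = y" using ne inj inf by (cases x; cases y) metis+
  qed
  show "range L_real = {z. norm z = 1}"
  proof (intro equalityI subsetI)
    fix z assume "z \<in> range L_real"
    then obtain x where x: "z = L_real x" by auto
    show "z \<in> {z. norm z = 1}"
    proof (cases x)
      case None then show ?thesis using x inf by simp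
    next
      case (Some r)
      have "norm (1 + \<i> * complex_of_real r) = norm (1 - \<i> * complex_of_real r)"
        by (simp add: cmod_def)
      then show ?thesis using x Some fin one_minus_ii_real[of r] by (simp add: norm_divide)
    qed
  next
    fix z :: complex assume "z \<in> {z. norm z = 1}"
    then have n: "(Re z)\<^sup>2 + (Im z)\<^sup>2 = 1" by (simp add: cmod_def)
    show "z \<in> range L_real"
    proof (cases "Re z = - 1")
      case True
      with n have "z = L_real Infty" by (simp add: inf complex_eq_iff)
      then show ?thesis by blast
    next
      case False
      define r where "r = Im z / (1 + Re z)"
      have d: "1 + Re z \<noteq> 0" using False by linarith
      have rd: "r * (1 + Re z) = Im z" using d by (simp add: r_def)
      have "(1 + Re z) * (r * Im z) = (1 + Re z) * (1 - Re z)"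
      proof -
        have "(1 + Re z) * (r * Im z) = (r * (1 + Re z)) * Im z" by (simp add: algebra_simps)
        then show ?thesis unfolding rd using n by (simp add: power2_eq_square algebra_simps)
      qed
      then have "Re z + r * Im z = 1" using d by simp
      moreover have "Im z - r * Re z = r" using rd by (simp add: algebra_simps)
      ultimately have "z * (1 - \<i> * of_real r) = 1 + \<i> * of_real r"
        by (simp add: complex_eq_iff algebra_simps)
      then have "z = L_real (Some r)"
        unfolding fin using one_minus_ii_real by (simp add: eq_divide_eq)
      then show ?thesis by blast
    qed
  qed
qed

definition plus_L :: "real proj_line \<Rightarrow> real proj_line \<Rightarrow> real proj_line"  (infixl \<open>+\<^sub>L\<close> 65)
  where "x +\<^sub>L y = inv_into UNIV L_real (L_real x * L_real y)"

text \<open>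
  The product stays on the unit circle, the range of \<^const>\<open>L_real\<close>, so the inverse in
  \<^const>\<open>plus_L\<close> is taken where it is defined.
\<close>

lemma L_real_plus_L: "L_real (x +\<^sub>L y) = L_real x * L_real y"
proof -
  have r: "range L_real = {z. norm z = 1}"
    using bij_betw_L_real by (simp add: bij_betw_def)
  have "norm (L_real u) = 1" for u
    using r by blast
  then have "L_real x * L_real y \<in> range L_real"
    unfolding r by (simp add: norm_mult)
  then show ?thesis unfolding plus_L_def by (rule f_inv_into_f)
qed

definition P1_group :: "real proj_line monoid"
  where "P1_group = \<lparr>carrier = UNIV, mult = (+\<^sub>L), one = Some 0\<rparr>"

end

theory Submission
  imports Defs
begin

text \<open>
  The map \<^const>\<open>L_real\<close> is a bijection onto the unit circle that turns \<open>+\<^sub>L\<close> into multiplication, so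
  every claim is checked there: the group laws are those of the circle, and \<open>\<infinity>\<close> corresponds to
  \<open>-1\<close>, the only element of order two. In homogeneous coordinates \<open>(a : b)\<close> goes to \<open>w / cnj w\<close> with
  \<open>w = b + \<i> a\<close>, so the addition formula is the multiplication of two such \<open>w\<close>.
\<close>

lemma inj_L_real: "inj L_real"
  and range_L_real: "range L_real = {z. norm z = 1}"
  using bij_betw_L_real by (auto simp: bij_betw_def)

lemma norm_L_real: "norm (L_real x) = 1"
  using range_L_real by blast

lemma L_real_None: "L_real None = - 1"
  by (simp add: L_real_def L_infty)

lemma L_real_zero: "L_real (Some 0) = 1"
  by (simp add: L_real_def L_Some)

text \<open>For \<open>b = 0\<close> the quotient collapses to -1 because \<open>a\<close> is then
  nonzero. Having one formula for all points spares the addition law a case split at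
  infinity.\<close>

lemma L_real_of_hom:
  assumes "(a, b) \<noteq> (0, 0)"
  shows "L_real (of_hom a b) =
    (complex_of_real b + \<i> * complex_of_real a) / (complex_of_real b - \<i> * complex_of_real a)"
proof (cases "b = 0")
  case True
  then show ?thesis
    using assms by (simp add: of_hom_def L_real_None)
next
  case False
  define B A where "B = complex_of_real b" and "A = complex_of_real a"
  have "L_real (of_hom a b) = (1 + \<i> * (A / B)) / (1 - \<i> * (A / B))"
    using False one_minus_ii_real[of "a / b"]
    by (simp add: of_hom_def L_real_def L_Some A_def B_def)
  also have "\<dots> = (B * (1 + \<i> * (A / B))) / (B * (1 - \<i> * (A / B)))"
    using False by (simp add: B_def)
  also have "\<dots> = (B + \<i> * A) / (B - \<i> * A)"
    using False by (simp add: B_def algebra_simps)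
  finally show ?thesis by (simp add: A_def B_def)
qed

text \<open>The two coordinates are the imaginary and real parts of
  \<open>(b0 + \<i> * a0) * (b1 + \<i> * a1)\<close>, a product of nonzero numbers; the identity in
  the proof is multiplicativity of the squared norm.\<close>

lemma hom_sum_nonzero:
  fixes a0 b0 a1 b1 :: real
  assumes "(a0, b0) \<noteq> (0, 0)" "(a1, b1) \<noteq> (0, 0)"
  shows "(a0 * b1 + a1 * b0, b0 * b1 - a0 * a1) \<noteq> (0, 0)"
proof -
  have "(a0 * b1 + a1 * b0)\<^sup>2 + (b0 * b1 - a0 * a1)\<^sup>2 = (a0\<^sup>2 + b0\<^sup>2) * (a1\<^sup>2 + b1\<^sup>2)"
    by (simp add: power2_eq_square algebra_simps)
  moreover have "a0\<^sup>2 + b0\<^sup>2 \<noteq> 0" "a1\<^sup>2 + b1\<^sup>2 \<noteq> 0"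
    using assms by (auto simp: sum_power2_eq_zero_iff)
  ultimately show ?thesis by auto
qed

lemma of_hom_plus_L:
  assumes "(a0, b0) \<noteq> (0, 0)" "(a1, b1) \<noteq> (0, 0)"
  shows "of_hom a0 b0 +\<^sub>L of_hom a1 b1 = of_hom (a0 * b1 + a1 * b0) (b0 * b1 - a0 * a1)"
proof (rule injD[OF inj_L_real])
  note eqs = L_real_plus_L L_real_of_hom[OF assms(1)] L_real_of_hom[OF assms(2)]
    L_real_of_hom[OF hom_sum_nonzero[OF assms]]
  show "L_real (of_hom a0 b0 +\<^sub>L of_hom a1 b1) =
      L_real (of_hom (a0 * b1 + a1 * b0) (b0 * b1 - a0 * a1))"
    \<comment> \<open>Numerators and denominators agree separately, so no factor has to be
      cancelled.\<close>
    unfolding eqs times_divide_times_eq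
    by (rule arg_cong2[where f = "(/)"]) (simp_all add: complex_eq_iff algebra_simps)
qed

lemma group_P1_group: "group P1_group"
proof (rule groupI)
  fix x assume "x \<in> carrier P1_group"
  \<comment> \<open>The inverse stays on the circle, so surjectivity of \<open>L_real\<close> onto
    the circle yields the witness \<open>y\<close>.\<close>
  have "norm (inverse (L_real x)) = 1"
    by (simp add: norm_inverse norm_L_real)
  then obtain y where "L_real y = inverse (L_real x)"
    using range_L_real by (metis (mono_tags, lifting) mem_Collect_eq rangeE)
  moreover have "L_real x \<noteq> 0"
    using norm_L_real[of x] by auto
  ultimately have "L_real (y +\<^sub>L x) = L_real (Some 0)"
    by (simp add: L_real_plus_L L_real_zero)
  then show "\<exists>y \<in> carrier P1_group. y \<otimes>\<^bsub>P1_group\<^esub> x = \<one>\<^bsub>P1_group\<^esub>"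
    using injD[OF inj_L_real] by (auto simp: P1_group_def)
qed (auto simp: P1_group_def L_real_plus_L L_real_zero intro!: injD[OF inj_L_real])

text \<open>The square roots of 1 are 1 and -1, the images of 0 and infinity.\<close>

lemma plus_L_self_eq_zero_iff: "x +\<^sub>L x = Some 0 \<longleftrightarrow> x = Some 0 \<or> x = Infty"
proof -
  have "x +\<^sub>L x = Some 0 \<longleftrightarrow> L_real x * L_real x = 1"
    using inj_eq[OF inj_L_real, of "x +\<^sub>L x" "Some 0"] by (simp add: L_real_plus_L L_real_zero)
  also have "\<dots> \<longleftrightarrow> L_real x = L_real (Some 0) \<or> L_real x = L_real Infty"
    by (simp add: square_eq_1_iff L_real_zero L_real_None)
  finally show ?thesis by (simp add: inj_eq[OF inj_L_real])
qed

text \<open>Reduces order two to the doubling equation, using that 2 is prime.\<close>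

lemma (in group) ord_eq_2_iff:
  assumes "x \<in> carrier G"
  shows "ord x = 2 \<longleftrightarrow> x \<noteq> \<one> \<and> x \<otimes> x = \<one>"
proof -
  have "x \<otimes> x = \<one> \<longleftrightarrow> ord x dvd 2"
    using pow_eq_id[OF assms, of 2] assms by (simp add: numeral_2_eq_2)
  moreover have "x = \<one> \<longleftrightarrow> ord x = 1"
    using ord_eq_1[OF assms] by simp
  \<comment> \<open>The value 0 of \<open>ord x\<close>, which encodes infinite order, is excluded
    since 0 does not divide 2.\<close>
  moreover have "ord x dvd 2 \<longleftrightarrow> ord x = 1 \<or> ord x = 2"
    using dvd_imp_le[of "ord x" 2] by (auto simp: le_Suc_eq numeral_2_eq_2)
  ultimately show ?thesis by auto
qed

theorem mainTheorem1:
  shows "(\<forall>a0 b0 a1 b1 :: real. (a0, b0) \<noteq> (0, 0) \<longrightarrow> (a1, b1) \<noteq> (0, 0) \<longrightarrow>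
            (a0 * b1 + a1 * b0, b0 * b1 - a0 * a1) \<noteq> (0, 0) \<and>
            of_hom a0 b0 +\<^sub>L of_hom a1 b1 = of_hom (a0 * b1 + a1 * b0) (b0 * b1 - a0 * a1))
       \<and> group P1_group
       \<and> {x \<in> carrier P1_group. group.ord P1_group x = 2} = {Infty}"
proof (intro conjI)
  show "\<forall>a0 b0 a1 b1 :: real. (a0, b0) \<noteq> (0, 0) \<longrightarrow> (a1, b1) \<noteq> (0, 0) \<longrightarrow>
      (a0 * b1 + a1 * b0, b0 * b1 - a0 * a1) \<noteq> (0, 0) \<and>
      of_hom a0 b0 +\<^sub>L of_hom a1 b1 = of_hom (a0 * b1 + a1 * b0) (b0 * b1 - a0 * a1)"
    using hom_sum_nonzero of_hom_plus_L by blast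
  show "group P1_group" by (rule group_P1_group)
  have "group.ord P1_group x = 2 \<longleftrightarrow> x = Infty" for x
    using group.ord_eq_2_iff[OF group_P1_group, of x] plus_L_self_eq_zero_iff[of x]
    by (auto simp: P1_group_def)
  then show "{x \<in> carrier P1_group. group.ord P1_group x = 2} = {Infty}"
    by (auto simp: P1_group_def)
qed

end
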